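(* Let $n>2$. If, for some constant $I_n>0$, the Sobolev inequality $$\|u\|_{L^{\frac{n}{n-1}}(X,\nu)}\le I_n\,TV_m(u)\quad\text{for all } u\in BV_m^0(X,\nu)$$ holds, then there exists $C_n>0$ such that $$\|u\|^2_{L^{\frac{2n}{n-2}}(X,\nu)}\le C_n\,\mathcal H_m(u)\quad\text{for all } u\in BV_m^0(X,\nu).$$
   Context: Metric random walk space: $(X,d)$ is a Polish metric space with its Borel $\sigma$-algebra and $m=(m_x)_{x\in X}$ is a family of Borel probability measures on $X$ such that $x\mapsto m_x(A)$ is Borel for every Borel set $A$, and each $m_x$ has finite first moment ($\int_X d(z,y)\,dm_x(y)<\infty$ for some, hence every, $z\in X$). $\nu$ is a $\sigma$-finite Radon measure on $X$ that is invariant, $\nu(A)=\int_X m_x(A)\,d\nu(x)$, and reversible for $m$: for every Borel $C\subset X\times X$, $\int_X\int_X\chi_C(x,y)\,dm_x(y)d\nu(x)=\int_X\int_X\chi_C(x,y)\,dm_y(x)d\nu(y)$. Put $L_m(A,B)=\int_A\int_B dm_x(y)d\nu(x)$; the space is assumed $m$-connected: $L_m(A,B)>0$ for any $\nu$-measurable sets $A,B$ of positive $\nu$-measure with $A\cup B=X$. For $\nu$-measurable $u:X\to\mathbb R$, $TV_m(u)=\frac12\int_X\int_X|u(y)-u(x)|\,dm_x(y)d\nu(x)$, and $BV_m(X,\nu)$ is the set of $\nu$-measurable $u$ with $TV_m(u)<\infty$. $BV_m^0(X,\nu)$ is the set of $u\in BV_m(X,\nu)$ for which there is $A\subset X$ with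 $0<\nu(A)<\nu(X)$ such that $u=0$ in $X\setminus A$. The Dirichlet energy is $\mathcal H_m(u)=\frac12\int_X\int_X(u(x)-u(y))^2\,dm_x(y)d\nu(x)$ if $u\in L^2(X,\nu)\cap L^1(X,\nu)$, and $\mathcal H_m(u)=+\infty$ otherwise. *)

theory Defs
  imports "HOL-Probability.Probability"
begin

text \<open>
  The Polish metric space is a type of class \<^class>\<open>polish_space\<close> (complete and second countable
  with respect to \<^const>\<open>dist\<close>). ``\<open>\<nu>\<close>-measurable'' means measurable with respect to
  \<^term>\<open>completion \<nu>\<close>.
\<close>

locale metric_random_walk_space =
  fixes m :: "'a::polish_space \<Rightarrow> 'a measure"
  assumes sets_rw: "sets (m x) = sets borel"
    and prob_space_rw: "prob_space (m x)"
    and measurable_rw: "A \<in> sets borel \<Longrightarrow> (\<lambda>x. emeasure (m x) A) \<in> borel_measurable borel"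
    and finite_first_moment: "\<exists>z. (\<integral>\<^sup>+ y. ennreal (dist z y) \<partial>m x) < \<infinity>"

definition radon_measure :: "'a::metric_space measure \<Rightarrow> bool" where
  "radon_measure \<nu> \<longleftrightarrow>
     sets \<nu> = sets borel \<and>
     (\<forall>x. \<exists>U. open U \<and> x \<in> U \<and> emeasure \<nu> U < \<infinity>) \<and>
     (\<forall>A\<in>sets borel. emeasure \<nu> A = (SUP K\<in>{K. compact K \<and> K \<subseteq> A}. emeasure \<nu> K))"

locale reversible_random_walk_space =
  metric_random_walk_space m + sigma_finite_measure \<nu>
  for m :: "'a::polish_space \<Rightarrow> 'a measure" and \<nu> :: "'a measure" +
  assumes radon: "radon_measure \<nu>"
    and invariant: "A \<in> sets borel \<Longrightarrow> emeasure \<nu> A = (\<integral>\<^sup>+ x. emeasure (m x) A \<partial>\<nu>)"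
    and reversible: "C \<in> sets (borel :: ('a \<times> 'a) measure) \<Longrightarrow>
      (\<integral>\<^sup>+ x. (\<integral>\<^sup>+ y. indicator C (x, y) \<partial>m x) \<partial>\<nu>) =
      (\<integral>\<^sup>+ y. (\<integral>\<^sup>+ x. indicator C (x, y) \<partial>m y) \<partial>\<nu>)"

text \<open>
  The iterated integrals below are applied to \<open>\<nu>\<close>-measurable sets and functions. Writing them with
  \<open>m x\<close> and \<open>\<nu>\<close> instead of the completions makes no difference, since the two nonnegative integrals
  agree on all functions (\<open>nn_integral_completion\<close>); by invariance a \<open>\<nu>\<close>-measurable function is
  measurable for the completion of \<open>m x\<close> for \<open>\<nu>\<close>-almost every \<open>x\<close>.
\<close>

definition L\<^sub>m :: "('a \<Rightarrow> 'a measure) \<Rightarrow> 'a measure \<Rightarrow> 'a set \<Rightarrow> 'a set \<Rightarrow> ennreal" where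
  "L\<^sub>m m \<nu> A B = (\<integral>\<^sup>+ x\<in>A. (\<integral>\<^sup>+ y\<in>B. 1 \<partial>m x) \<partial>\<nu>)"

definition m_connected :: "('a \<Rightarrow> 'a measure) \<Rightarrow> 'a measure \<Rightarrow> bool" where
  "m_connected m \<nu> \<longleftrightarrow>
     (\<forall>A\<in>sets (completion \<nu>). \<forall>B\<in>sets (completion \<nu>).
        emeasure (completion \<nu>) A > 0 \<and> emeasure (completion \<nu>) B > 0 \<and> A \<union> B = UNIV \<longrightarrow>
        L\<^sub>m m \<nu> A B > 0)"

definition TV\<^sub>m :: "('a \<Rightarrow> 'a measure) \<Rightarrow> 'a measure \<Rightarrow> ('a \<Rightarrow> real) \<Rightarrow> ennreal" where
  "TV\<^sub>m m \<nu> u = (1 / 2) * (\<integral>\<^sup>+ x. (\<integral>\<^sup>+ y. ennreal \<bar>u y - u x\<bar> \<partial>m x) \<partial>\<nu>)"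

definition BV\<^sub>m :: "('a \<Rightarrow> 'a measure) \<Rightarrow> 'a measure \<Rightarrow> ('a \<Rightarrow> real) set" where
  "BV\<^sub>m m \<nu> = {u \<in> borel_measurable (completion \<nu>). TV\<^sub>m m \<nu> u < \<infinity>}"

definition BV\<^sub>m0 :: "('a \<Rightarrow> 'a measure) \<Rightarrow> 'a measure \<Rightarrow> ('a \<Rightarrow> real) set" where
  "BV\<^sub>m0 m \<nu> = {u \<in> BV\<^sub>m m \<nu>. \<exists>A\<in>sets (completion \<nu>).
     0 < emeasure (completion \<nu>) A \<and> emeasure (completion \<nu>) A < emeasure (completion \<nu>) UNIV \<and>
     (\<forall>x\<in>UNIV - A. u x = 0)}"

text \<open>
  The extended-valued \<open>L\<^sup>p\<close> norm for \<open>0 < p < \<infinity>\<close>. As \<open>powr\<close> is not available on \<^typ>\<open>ennreal\<close>, the value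
  \<open>\<infinity>\<close> of the integral is treated separately.
\<close>

definition Lp_norm :: "'a measure \<Rightarrow> real \<Rightarrow> ('a \<Rightarrow> real) \<Rightarrow> ennreal" where
  "Lp_norm \<nu> p u =
     (let I = (\<integral>\<^sup>+ x. ennreal (\<bar>u x\<bar> powr p) \<partial>\<nu>)
      in if I = \<infinity> then \<infinity> else ennreal (enn2real I powr (1 / p)))"

definition Lp_space :: "'a measure \<Rightarrow> real \<Rightarrow> ('a \<Rightarrow> real) set" where
  "Lp_space \<nu> p = {u \<in> borel_measurable (completion \<nu>). Lp_norm \<nu> p u < \<infinity>}"

definition H\<^sub>m :: "('a \<Rightarrow> 'a measure) \<Rightarrow> 'a measure \<Rightarrow> ('a \<Rightarrow> real) \<Rightarrow> ennreal" where
  "H\<^sub>m m \<nu> u =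
     (if u \<in> Lp_space \<nu> 2 \<inter> Lp_space \<nu> 1
      then (1 / 2) * (\<integral>\<^sup>+ x. (\<integral>\<^sup>+ y. ennreal ((u x - u y)\<^sup>2) \<partial>m x) \<partial>\<nu>)
      else \<infinity>)"

end

theory Submission
  imports Defs
begin

text \<open>
  The inequality follows by applying the hypothesis to a power of \<open>\<bar>u\<bar>\<close>. Write
  \<open>q = 2n/(n-2)\<close> and \<open>p = 2(n-1)/(n-2)\<close>, so that \<open>p \<cdot> n/(n-1) = q = 2(p-1)\<close>. A chain rule
  inequality for \<open>\<bar>t\<bar>\<^sup>p\<close>, reversibility and Cauchy--Schwarz give (\<open>TV_powr_le\<close>)
  \[ TV(\<bar>u\<bar>^p)^2 \<le> 2 p^2 \, H(u) \int \<bar>u\<bar>^{2(p-1)} d\<nu> = 2 p^2 \, H(u) \int \<bar>u\<bar>^q d\<nu> , \]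
  while the Sobolev inequality for \<open>\<bar>u\<bar>\<^sup>p\<close>, which vanishes wherever \<open>u\<close> does, bounds
  \<open>(\<integral>\<bar>u\<bar>\<^sup>q)\<close> to the power \<open>(n-1)/n\<close> by \<open>I \<cdot> TV(\<bar>u\<bar>\<^sup>p)\<close>. Since \<open>2(n-1)/n > 1\<close>, one factor
  \<open>\<integral>\<bar>u\<bar>\<^sup>q\<close> of the squared inequality can be cancelled (\<open>absorb_powr\<close>); what remains is the claim
  with \<open>C = 2 I\<^sup>2 p\<^sup>2\<close>.

  The cancellation needs \<open>\<integral>\<bar>u\<bar>\<^sup>q < \<infinity>\<close>, and the Sobolev inequality needs \<open>TV(\<bar>u\<bar>\<^sup>p) < \<infinity>\<close>.
  Both hold for the truncations of \<open>u\<close> at heights \<open>\<plusminus>k\<close>, because a bounded function in \<open>L\<^sup>2\<close> lies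
  in \<open>L\<^sup>q\<close> for every \<open>q \<ge> 2\<close> (a finite energy includes \<open>u \<in> L\<^sup>2\<close>). Truncation does not increase
  the energy, so the bound is uniform in \<open>k\<close> and passes to \<open>u\<close> by monotone convergence
  (\<open>powr_integral_le\<close>).
\<close>

section \<open>A chain rule inequality for powers\<close>

lemma powr_diff_le_of_le:
  fixes a b p :: real
  assumes "1 \<le> p" "0 \<le> b" "b \<le> a"
  shows "a powr p - b powr p \<le> p * a powr (p - 1) * (a - b)"
proof (cases "b = 0 \<or> a = b")
  case True
  have "a powr p = a powr (p - 1) * a" if "0 < a"
    using that by (simp add: powr_diff)
  moreover have "a powr (p - 1) * a \<le> p * a powr (p - 1) * a"
    using assms mult_right_mono[of 1 p "a powr (p - 1) * a"] by (simp add: mult.assoc)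
  ultimately show ?thesis
    using True assms by (cases "a = 0") auto
next
  case False
  then have ab: "0 < b" "b < a" using assms by auto
  have "\<exists>z>b. z < a \<and> a powr p - b powr p = (a - b) * (p * z powr (p - 1))"
  proof (rule MVT2[OF ab(2)])
    fix x assume "b \<le> x"
    then show "((\<lambda>x. x powr p) has_real_derivative p * x powr (p - 1)) (at x)"
      using ab by (intro has_real_derivative_powr) auto
  qed
  then obtain z where z: "b < z" "z < a" "a powr p - b powr p = (a - b) * (p * z powr (p - 1))"
    by blast
  have "z powr (p - 1) \<le> a powr (p - 1)"
    using z ab assms by (intro powr_mono2) auto
  then have "(a - b) * (p * z powr (p - 1)) \<le> (a - b) * (p * a powr (p - 1))"
    using ab assms by (intro mult_left_mono) auto
  with z show ?thesis by (simp add: mult_ac)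
qed

text \<open>
  The factor \<open>max \<bar>a\<bar> \<bar>b\<bar>\<close> to the power \<open>p - 1\<close> from the mean value theorem is replaced by a sum
  over \<open>a\<close> and \<open>b\<close>: the two terms are mirror images under exchanging \<open>a\<close> and \<open>b\<close>, hence have
  equal integrals for a reversible random walk.
\<close>

lemma abs_powr_diff_le:
  fixes a b p :: real
  assumes "1 \<le> p"
  shows "\<bar>\<bar>b\<bar> powr p - \<bar>a\<bar> powr p\<bar>
           \<le> p * (\<bar>a\<bar> powr (p - 1) * \<bar>b - a\<bar> + \<bar>b\<bar> powr (p - 1) * \<bar>b - a\<bar>)"
proof -
  have *: "\<bar>\<bar>b\<bar> powr p - \<bar>a\<bar> powr p\<bar>
             \<le> p * (\<bar>a\<bar> powr (p - 1) * \<bar>b - a\<bar> + \<bar>b\<bar> powr (p - 1) * \<bar>b - a\<bar>)"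
    if "\<bar>b\<bar> \<le> \<bar>a\<bar>" for a b :: real
  proof -
    have "\<bar>b\<bar> powr p \<le> \<bar>a\<bar> powr p"
      using that assms by (intro powr_mono2) auto
    then have "\<bar>\<bar>b\<bar> powr p - \<bar>a\<bar> powr p\<bar> \<le> p * \<bar>a\<bar> powr (p - 1) * (\<bar>a\<bar> - \<bar>b\<bar>)"
      using powr_diff_le_of_le[OF assms, of "\<bar>b\<bar>" "\<bar>a\<bar>"] that by auto
    also have "\<dots> \<le> p * \<bar>a\<bar> powr (p - 1) * \<bar>b - a\<bar>"
      using assms by (intro mult_left_mono) auto
    also have "\<dots> \<le> p * (\<bar>a\<bar> powr (p - 1) * \<bar>b - a\<bar> + \<bar>b\<bar> powr (p - 1) * \<bar>b - a\<bar>)"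
      using assms by (simp add: algebra_simps)
    finally show ?thesis .
  qed
  show ?thesis
  proof (cases "\<bar>b\<bar> \<le> \<bar>a\<bar>")
    case True
    then show ?thesis by (rule *)
  next
    case False
    then show ?thesis using *[of a b] by (simp add: abs_minus_commute add.commute)
  qed
qed

section \<open>Iterated integrals against the random walk\<close>

context reversible_random_walk_space
begin

lemma sets_\<nu>: "sets \<nu> = sets borel"
  using radon by (simp add: radon_measure_def)

lemma kernel_measurable: "m \<in> borel \<rightarrow>\<^sub>M subprob_algebra borel"
proof (rule measurable_subprob_algebra)
  show "subprob_space (m x)" for x
    by (rule prob_space_imp_subprob_space[OF prob_space_rw])
qed (auto simp: sets_rw measurable_rw)

lemma iterated_measurable:
  fixes f :: "'a \<times> 'a \<Rightarrow> ennreal"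
  assumes f: "f \<in> borel_measurable (borel \<Otimes>\<^sub>M borel)"
  shows "(\<lambda>y. f (x, y)) \<in> borel_measurable (m z)"
    and "(\<lambda>x. \<integral>\<^sup>+ y. f (x, y) \<partial>m x) \<in> borel_measurable \<nu>"
proof -
  have "(\<lambda>y. f (x, y)) \<in> borel_measurable borel"
    using f by measurable
  then show "(\<lambda>y. f (x, y)) \<in> borel_measurable (m z)"
    by (simp add: sets_rw cong: measurable_cong_sets)
  have "(\<lambda>x. \<integral>\<^sup>+ y. f (x, y) \<partial>m x) \<in> borel_measurable borel"
    using f by (intro nn_integral_measurable_subprob_algebra2[OF _ kernel_measurable]) simp
  then show "(\<lambda>x. \<integral>\<^sup>+ y. f (x, y) \<partial>m x) \<in> borel_measurable \<nu>"
    by (simp add: sets_\<nu> cong: measurable_cong_sets)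
qed

lemma swapped_measurable:
  fixes f :: "'a \<times> 'a \<Rightarrow> ennreal"
  assumes f: "f \<in> borel_measurable (borel \<Otimes>\<^sub>M borel)"
  shows "(\<lambda>y. f (y, x)) \<in> borel_measurable (m z)"
    and "(\<lambda>x. \<integral>\<^sup>+ y. f (y, x) \<partial>m x) \<in> borel_measurable \<nu>"
proof -
  have "(\<lambda>(x, y). f (y, x)) \<in> borel_measurable (borel \<Otimes>\<^sub>M borel)"
    using f by measurable
  from iterated_measurable[OF this]
  show "(\<lambda>y. f (y, x)) \<in> borel_measurable (m z)"
    and "(\<lambda>x. \<integral>\<^sup>+ y. f (y, x) \<partial>m x) \<in> borel_measurable \<nu>"
    by simp_all
qed

text \<open>
  Reversibility says this for indicator functions; both sides are additive, homogeneous and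
  continuous along increasing sequences in \<open>f\<close>.
\<close>

lemma nn_integral_reversible:
  fixes f :: "'a \<times> 'a \<Rightarrow> ennreal"
  assumes "f \<in> borel_measurable (borel \<Otimes>\<^sub>M borel)"
  shows "(\<integral>\<^sup>+ x. \<integral>\<^sup>+ y. f (x, y) \<partial>m x \<partial>\<nu>) = (\<integral>\<^sup>+ x. \<integral>\<^sup>+ y. f (y, x) \<partial>m x \<partial>\<nu>)"
  using assms
proof (induction rule: borel_measurable_induct)
  case (cong f g)
  then have "f = g"
    by (auto simp: space_pair_measure)
  with cong show ?case by simp
next
  case (set A)
  then show ?case
    using reversible[of A] by (simp add: borel_prod[symmetric])
next
  case (mult f c)
  note meas = iterated_measurable[OF mult(2)] swapped_measurable[OF mult(2)]
  show ?case
    using mult(4) by (simp add: nn_integral_cmult meas)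
next
  case (add f g)
  note f = \<open>f \<in> borel_measurable _\<close> and g = \<open>g \<in> borel_measurable _\<close>
  note meas = iterated_measurable[OF f] swapped_measurable[OF f]
    iterated_measurable[OF g] swapped_measurable[OF g]
  show ?case
    using add.IH by (simp add: nn_integral_add meas)
next
  case (seq U)
  note meas = iterated_measurable[OF seq(1)] swapped_measurable[OF seq(1)]
  have inc: "incseq (\<lambda>i y. U i (x, y))" "incseq (\<lambda>i y. U i (y, x))" for x
    using seq(3) by (auto simp: incseq_def le_fun_def)
  have inc2: "incseq (\<lambda>i x. \<integral>\<^sup>+ y. U i (x, y) \<partial>m x)" "incseq (\<lambda>i x. \<integral>\<^sup>+ y. U i (y, x) \<partial>m x)"
    using seq(3) by (auto simp: incseq_def le_fun_def intro!: nn_integral_mono)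
  have "(\<integral>\<^sup>+ x. \<integral>\<^sup>+ y. (SUP i. U i (x, y)) \<partial>m x \<partial>\<nu>) = (SUP i. \<integral>\<^sup>+ x. \<integral>\<^sup>+ y. U i (x, y) \<partial>m x \<partial>\<nu>)"
    by (simp add: nn_integral_monotone_convergence_SUP inc inc2 meas)
  moreover have "(\<integral>\<^sup>+ x. \<integral>\<^sup>+ y. (SUP i. U i (y, x)) \<partial>m x \<partial>\<nu>) = (SUP i. \<integral>\<^sup>+ x. \<integral>\<^sup>+ y. U i (y, x) \<partial>m x \<partial>\<nu>)"
    by (simp add: nn_integral_monotone_convergence_SUP inc inc2 meas)
  ultimately show ?case
    using seq.IH by (simp add: SUP_apply[abs_def] image_comp)
qed

text \<open>By invariance, \<open>\<integral> m\<^sub>x(N) d\<nu>(x) = \<nu>(N) = 0\<close> for a \<open>\<nu>\<close>-null Borel set \<open>N\<close>.\<close>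

lemma AE_kernel:
  assumes "AE x in \<nu>. P x"
  shows "AE x in \<nu>. AE y in m x. P y"
proof -
  obtain N where N: "{x \<in> space \<nu>. \<not> P x} \<subseteq> N" "emeasure \<nu> N = 0" "N \<in> sets \<nu>"
    using assms by (rule AE_E)
  have space: "space \<nu> = UNIV" "space (m x) = UNIV" for x
    using sets_eq_imp_space_eq[OF sets_\<nu>] sets_eq_imp_space_eq[OF sets_rw, of x] by auto
  have "(\<integral>\<^sup>+ x. emeasure (m x) N \<partial>\<nu>) = 0"
    using N invariant[of N] by (simp add: sets_\<nu>)
  then have "AE x in \<nu>. emeasure (m x) N = 0"
    using N measurable_rw[of N]
    by (subst (asm) nn_integral_0_iff_AE) (auto simp: sets_\<nu> cong: measurable_cong_sets)
  then show ?thesis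
  proof eventually_elim
    case (elim x)
    then show ?case
      using N by (intro AE_I[of _ _ N]) (auto simp: space sets_rw sets_\<nu>)
  qed
qed

text \<open>
  This lets a \<open>\<nu>\<close>-measurable function be replaced by a Borel version inside the total variation and
  the energy. It holds for arbitrary \<open>F\<close>, \<open>u\<close> and \<open>v\<close>, because nonnegative integrals of almost
  everywhere equal functions agree even without measurability.
\<close>

lemma iterated_integral_cong_AE:
  assumes "AE x in \<nu>. u x = v x"
  shows "(\<integral>\<^sup>+ x. \<integral>\<^sup>+ y. F (u x) (u y) \<partial>m x \<partial>\<nu>) = (\<integral>\<^sup>+ x. \<integral>\<^sup>+ y. F (v x) (v y) \<partial>m x \<partial>\<nu>)"
proof (rule nn_integral_cong_AE)
  show "AE x in \<nu>. (\<integral>\<^sup>+ y. F (u x) (u y) \<partial>m x) = (\<integral>\<^sup>+ y. F (v x) (v y) \<partial>m x)"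
    using assms AE_kernel[OF assms]
  proof eventually_elim
    case (elim x)
    show ?case
      by (rule nn_integral_cong_AE) (use elim in auto)
  qed
qed

section \<open>Total variation of a power\<close>

text \<open>
  Integrating \<open>abs_powr_diff_le\<close> and using reversibility, \<open>TV(\<bar>v\<bar>\<^sup>p)\<close> is at most \<open>p\<close> times
  \<open>J = \<integral> a B d\<nu>\<close>, where \<open>a\<close> is \<open>\<bar>v\<bar>\<close> to the power \<open>p - 1\<close> and \<open>B x\<close> is the mean of
  \<open>\<bar>v y - v x\<bar>\<close> under \<open>m x\<close>. Cauchy--Schwarz is applied to \<open>J\<close> over \<open>\<nu>\<close>, and then to \<open>B x\<close>
  over the probability measure \<open>m x\<close>.
\<close>

lemma TV_powr_le_borel:
  fixes v :: "'a \<Rightarrow> real"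
  assumes v[measurable]: "v \<in> borel_measurable borel" and p: "1 \<le> p"
  shows "(TV\<^sub>m m \<nu> (\<lambda>x. \<bar>v x\<bar> powr p))\<^sup>2
    \<le> ennreal (p\<^sup>2) * (\<integral>\<^sup>+ x. ennreal (\<bar>v x\<bar> powr (2 * (p - 1))) \<partial>\<nu>)
        * (\<integral>\<^sup>+ x. \<integral>\<^sup>+ y. ennreal ((v x - v y)\<^sup>2) \<partial>m x \<partial>\<nu>)"
proof -
  define a where "a x = ennreal (\<bar>v x\<bar> powr (p - 1))" for x
  define b where "b x y = ennreal \<bar>v y - v x\<bar>" for x y
  define B where "B x = (\<integral>\<^sup>+ y. b x y \<partial>m x)" for x
  define J where "J = (\<integral>\<^sup>+ x. a x * B x \<partial>\<nu>)"
  have a[measurable]: "a \<in> borel_measurable borel"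
    unfolding a_def by measurable
  have a\<nu>: "a \<in> borel_measurable \<nu>"
    using a by (simp add: sets_\<nu> cong: measurable_cong_sets)
  have b[measurable]: "(\<lambda>(x, y). b x y) \<in> borel_measurable (borel \<Otimes>\<^sub>M borel)"
    unfolding b_def by measurable
  have ab: "(\<lambda>(x, y). a x * b x y) \<in> borel_measurable (borel \<Otimes>\<^sub>M borel)"
    by measurable
  have b_sym: "b y x = b x y" for x y
    by (simp add: b_def abs_minus_commute)
  note b_meas = iterated_measurable[OF b, unfolded prod.case]
  note ab_meas = iterated_measurable[OF ab, unfolded prod.case]
  have ba: "(\<lambda>(x, y). a y * b x y) \<in> borel_measurable (borel \<Otimes>\<^sub>M borel)"
    by measurable
  note ba_meas = iterated_measurable[OF ba, unfolded prod.case]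
  have B: "B \<in> borel_measurable \<nu>"
    unfolding B_def using b_meas by simp
  have J1: "(\<integral>\<^sup>+ x. \<integral>\<^sup>+ y. a x * b x y \<partial>m x \<partial>\<nu>) = J"
    unfolding J_def B_def by (intro nn_integral_cong nn_integral_cmult b_meas)
  have J2: "(\<integral>\<^sup>+ x. \<integral>\<^sup>+ y. a y * b x y \<partial>m x \<partial>\<nu>) = J"
    using nn_integral_reversible[OF ba] J1 by (simp add: b_sym)
  have "(\<integral>\<^sup>+ x. \<integral>\<^sup>+ y. ennreal \<bar>\<bar>v y\<bar> powr p - \<bar>v x\<bar> powr p\<bar> \<partial>m x \<partial>\<nu>)
      \<le> (\<integral>\<^sup>+ x. \<integral>\<^sup>+ y. ennreal p * (a x * b x y + a y * b x y) \<partial>m x \<partial>\<nu>)"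
  proof (intro nn_integral_mono)
    fix x y
    show "ennreal \<bar>\<bar>v y\<bar> powr p - \<bar>v x\<bar> powr p\<bar> \<le> ennreal p * (a x * b x y + a y * b x y)"
      using abs_powr_diff_le[OF p, of "v y" "v x"] p
      by (simp add: a_def b_def flip: ennreal_mult' ennreal_plus)
  qed
  also have "\<dots> = ennreal p * (J + J)"
    by (subst nn_integral_cmult nn_integral_add, (intro borel_measurable_add ab_meas ba_meas)+)+
      (simp only: J1 J2)
  finally have "TV\<^sub>m m \<nu> (\<lambda>x. \<bar>v x\<bar> powr p) \<le> 1 / 2 * (ennreal p * (J + J))"
    unfolding TV\<^sub>m_def by (rule mult_left_mono) simp
  also have "\<dots> = ennreal p * J"
  proof -
    have "(1 / 2 :: ennreal) * 2 = 1"
      by (simp add: ennreal_divide_times)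
    moreover have "1 / 2 * (ennreal p * (J + J)) = (1 / 2 * 2) * (ennreal p * J)"
      by (simp only: mult_2[symmetric] mult_ac)
    ultimately show ?thesis
      by simp
  qed
  finally have "(TV\<^sub>m m \<nu> (\<lambda>x. \<bar>v x\<bar> powr p))\<^sup>2 \<le> (ennreal p * J)\<^sup>2"
    by (rule power_mono) simp
  also have "\<dots> = ennreal (p\<^sup>2) * J\<^sup>2"
    using p by (simp add: power_mult_distrib ennreal_power)
  also have "J\<^sup>2 \<le> (\<integral>\<^sup>+ x. (a x)\<^sup>2 \<partial>\<nu>) * (\<integral>\<^sup>+ x. (B x)\<^sup>2 \<partial>\<nu>)"
    unfolding J_def by (rule Cauchy_Schwarz_nn_integral[OF a\<nu> B])
  also have "(\<integral>\<^sup>+ x. (a x)\<^sup>2 \<partial>\<nu>) = (\<integral>\<^sup>+ x. ennreal (\<bar>v x\<bar> powr (2 * (p - 1))) \<partial>\<nu>)"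
    by (simp only: a_def power2_eq_square mult_2 powr_add
        ennreal_mult[OF powr_ge_zero powr_ge_zero])
  also have "(\<integral>\<^sup>+ x. (B x)\<^sup>2 \<partial>\<nu>) \<le> (\<integral>\<^sup>+ x. \<integral>\<^sup>+ y. ennreal ((v x - v y)\<^sup>2) \<partial>m x \<partial>\<nu>)"
  proof (rule nn_integral_mono)
    fix x
    have "(B x)\<^sup>2 \<le> (\<integral>\<^sup>+ y. (b x y)\<^sup>2 \<partial>m x) * (\<integral>\<^sup>+ y. 1\<^sup>2 \<partial>m x)"
      unfolding B_def using Cauchy_Schwarz_nn_integral[of "b x" "m x" "\<lambda>_. 1"]
      by (simp add: b_meas)
    then show "(B x)\<^sup>2 \<le> (\<integral>\<^sup>+ y. ennreal ((v x - v y)\<^sup>2) \<partial>m x)"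
      by (simp add: prob_space.emeasure_space_1[OF prob_space_rw] b_def ennreal_power
          power2_commute)
  qed
  finally show ?thesis
    by (simp add: mult.assoc mult_left_mono)
qed

lemma TV_powr_le:
  fixes u :: "'a \<Rightarrow> real"
  assumes "u \<in> borel_measurable (completion \<nu>)" and p: "1 \<le> p"
  shows "(TV\<^sub>m m \<nu> (\<lambda>x. \<bar>u x\<bar> powr p))\<^sup>2
    \<le> ennreal (p\<^sup>2) * (\<integral>\<^sup>+ x. ennreal (\<bar>u x\<bar> powr (2 * (p - 1))) \<partial>\<nu>)
        * (\<integral>\<^sup>+ x. \<integral>\<^sup>+ y. ennreal ((u x - u y)\<^sup>2) \<partial>m x \<partial>\<nu>)"
proof -
  obtain v where v: "v \<in> borel_measurable \<nu>" and uv: "AE x in \<nu>. u x = v x"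
    using completion_ex_borel_measurable_real[OF assms(1)] by blast
  have v': "v \<in> borel_measurable borel"
    using v by (simp add: sets_\<nu> cong: measurable_cong_sets)
  have "(\<integral>\<^sup>+ x. ennreal (\<bar>u x\<bar> powr (2 * (p - 1))) \<partial>\<nu>)
      = (\<integral>\<^sup>+ x. ennreal (\<bar>v x\<bar> powr (2 * (p - 1))) \<partial>\<nu>)"
    using uv by (intro nn_integral_cong_AE) auto
  then show ?thesis
    using TV_powr_le_borel[OF v' p]
      iterated_integral_cong_AE[OF uv, of "\<lambda>s t. ennreal ((s - t)\<^sup>2)"]
      iterated_integral_cong_AE[OF uv, of "\<lambda>s t. ennreal \<bar>\<bar>t\<bar> powr p - \<bar>s\<bar> powr p\<bar>"]
    by (simp add: TV\<^sub>m_def)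
qed

end

section \<open>From the Sobolev inequality to the energy inequality\<close>

text \<open>
  The square of the first inequality in \<open>*\<close> has the exponent \<open>2(n-1)/n = (n-2)/n + 1\<close> on the left;
  the summand \<open>1\<close> cancels against the factor \<open>s\<close> that the second inequality produces on the right.
\<close>

lemma absorb_powr:
  fixes n s t I K :: real
  assumes n: "2 < n" and "0 \<le> s" "0 \<le> t" "0 \<le> K"
    and *: "s powr ((n - 1) / n) \<le> I * t" "t\<^sup>2 \<le> K * s"
  shows "s powr ((n - 2) / n) \<le> I\<^sup>2 * K"
proof (cases "s = 0")
  case True
  then show ?thesis using assms by simp
next
  case False
  then have s: "0 < s" using assms by simp
  have "s powr ((n - 2) / n) * s = s powr ((n - 2) / n + 1)"
    using s by (simp add: powr_add)
  also have "(n - 2) / n + 1 = (n - 1) / n + (n - 1) / n"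
    using n by (simp add: field_simps)
  also have "s powr \<dots> = (s powr ((n - 1) / n))\<^sup>2"
    by (simp only: powr_add power2_eq_square)
  also have "\<dots> \<le> (I * t)\<^sup>2"
    using * by (intro power_mono) auto
  also have "\<dots> \<le> I\<^sup>2 * (K * s)"
    using * by (simp add: power_mult_distrib mult_left_mono)
  finally show ?thesis
    using s by (simp add: mult.assoc[symmetric])
qed

text \<open>
  The Sobolev inequality is applied to \<open>w = \<bar>u\<bar>\<^sup>p\<close>. Its total
  variation is finite by \<open>TV_powr_le\<close>. The hypotheses on \<open>u\<close> are those that truncations of a function
  in \<open>BV\<^sub>m0\<close> satisfy; the energy enters through an upper bound \<open>d\<close>, so that one bound serves all truncations of a function.
\<close>

lemma (in reversible_random_walk_space) powr_integral_le_of_finite: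
  fixes u :: "'a \<Rightarrow> real" and n I :: real
  defines "q \<equiv> 2 * n / (n - 2)" and "p \<equiv> 2 * (n - 1) / (n - 2)"
  assumes n: "2 < n" and I: "0 < I"
    and sobolev: "\<And>w. w \<in> BV\<^sub>m0 m \<nu> \<Longrightarrow> Lp_norm \<nu> (n / (n - 1)) w \<le> ennreal I * TV\<^sub>m m \<nu> w"
    and u: "u \<in> borel_measurable (completion \<nu>)"
    and A: "A \<in> sets (completion \<nu>)" "0 < emeasure (completion \<nu>) A"
      "emeasure (completion \<nu>) A < emeasure (completion \<nu>) UNIV" "\<And>x. x \<notin> A \<Longrightarrow> u x = 0"
    and fin: "(\<integral>\<^sup>+ x. ennreal (\<bar>u x\<bar> powr q) \<partial>\<nu>) < \<infinity>"
    and d: "0 \<le> d" "(\<integral>\<^sup>+ x. \<integral>\<^sup>+ y. ennreal ((u x - u y)\<^sup>2) \<partial>m x \<partial>\<nu>) \<le> ennreal d"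
  shows "(\<integral>\<^sup>+ x. ennreal (\<bar>u x\<bar> powr q) \<partial>\<nu>) \<le> ennreal ((I\<^sup>2 * (p\<^sup>2 * d)) powr (n / (n - 2)))"
proof -
  have p: "1 \<le> p" "2 * (p - 1) = q"
    using n by (auto simp: p_def q_def field_simps)
  have pq: "p * (n / (n - 1)) = q"
    using n by (simp add: p_def q_def divide_simps)
  obtain s where s: "(\<integral>\<^sup>+ x. ennreal (\<bar>u x\<bar> powr q) \<partial>\<nu>) = ennreal s" "0 \<le> s"
    using fin by (cases "\<integral>\<^sup>+ x. ennreal (\<bar>u x\<bar> powr q) \<partial>\<nu>") auto
  define w where "w x = \<bar>u x\<bar> powr p" for x
  have w2: "(TV\<^sub>m m \<nu> w)\<^sup>2 \<le> ennreal (p\<^sup>2 * d * s)"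
  proof -
    have "(TV\<^sub>m m \<nu> w)\<^sup>2 \<le> ennreal (p\<^sup>2) * ennreal s
        * (\<integral>\<^sup>+ x. \<integral>\<^sup>+ y. ennreal ((u x - u y)\<^sup>2) \<partial>m x \<partial>\<nu>)"
      using TV_powr_le[OF u p(1)] unfolding p(2) s(1) w_def[abs_def] .
    also have "\<dots> \<le> ennreal (p\<^sup>2) * ennreal s * ennreal d"
      using d by (intro mult_left_mono) auto
    also have "\<dots> = ennreal (p\<^sup>2 * d * s)"
      using s d by (simp add: mult_ac flip: ennreal_mult)
    finally show ?thesis .
  qed
  then have "TV\<^sub>m m \<nu> w < \<infinity>"
    by (cases "TV\<^sub>m m \<nu> w") (auto simp: power2_eq_square top_unique ennreal_mult_top)
  then obtain t where t: "TV\<^sub>m m \<nu> w = ennreal t" "0 \<le> t"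
    by (cases "TV\<^sub>m m \<nu> w") auto
  have w: "w \<in> BV\<^sub>m0 m \<nu>"
    using A u \<open>TV\<^sub>m m \<nu> w < \<infinity>\<close> p(1) unfolding BV\<^sub>m0_def BV\<^sub>m_def w_def[abs_def]
    by (auto intro!: bexI[of _ A])
  have "(\<integral>\<^sup>+ x. ennreal (\<bar>w x\<bar> powr (n / (n - 1))) \<partial>\<nu>) = ennreal s"
    using s unfolding w_def by (simp only: powr_powr pq abs_of_nonneg[OF powr_ge_zero])
  then have "Lp_norm \<nu> (n / (n - 1)) w = ennreal (s powr ((n - 1) / n))"
    using s by (simp add: Lp_norm_def)
  with sobolev[OF w] have "ennreal (s powr ((n - 1) / n)) \<le> ennreal (I * t)"
    using I t by (simp add: ennreal_mult)
  then have "s powr ((n - 1) / n) \<le> I * t"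
    using I t by simp
  moreover have "t\<^sup>2 \<le> p\<^sup>2 * d * s"
    using w2 t d s by (simp add: ennreal_power)
  ultimately have "s powr ((n - 2) / n) \<le> I\<^sup>2 * (p\<^sup>2 * d)"
    using n s t d by (intro absorb_powr) auto
  then have "(s powr ((n - 2) / n)) powr (n / (n - 2)) \<le> (I\<^sup>2 * (p\<^sup>2 * d)) powr (n / (n - 2))"
    using n by (intro powr_mono2) auto
  then show ?thesis
    using n s by (simp add: powr_powr ennreal_leI)
qed

text \<open>
  The truncations \<open>U k\<close> of \<open>u\<close> satisfy the integrability hypothesis of the previous lemma, and
  \<open>\<bar>U k\<bar>\<close> increases to \<open>\<bar>u\<bar>\<close>. Integrals over \<open>\<nu>\<close> are rewritten over its completion where \<open>u\<close>
  has to be measurable.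
\<close>

lemma (in reversible_random_walk_space) powr_integral_le:
  fixes u :: "'a \<Rightarrow> real" and n I :: real
  defines "q \<equiv> 2 * n / (n - 2)" and "p \<equiv> 2 * (n - 1) / (n - 2)"
  assumes n: "2 < n" and I: "0 < I"
    and sobolev: "\<And>w. w \<in> BV\<^sub>m0 m \<nu> \<Longrightarrow> Lp_norm \<nu> (n / (n - 1)) w \<le> ennreal I * TV\<^sub>m m \<nu> w"
    and u: "u \<in> BV\<^sub>m0 m \<nu>"
    and L2: "(\<integral>\<^sup>+ x. ennreal ((u x)\<^sup>2) \<partial>\<nu>) < \<infinity>"
    and d: "0 \<le> d" "(\<integral>\<^sup>+ x. \<integral>\<^sup>+ y. ennreal ((u x - u y)\<^sup>2) \<partial>m x \<partial>\<nu>) \<le> ennreal d"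
  shows "(\<integral>\<^sup>+ x. ennreal (\<bar>u x\<bar> powr q) \<partial>\<nu>) \<le> ennreal ((I\<^sup>2 * (p\<^sup>2 * d)) powr (n / (n - 2)))"
    (is "?S \<le> ?K")
proof -
  have q: "2 \<le> q"
    using n by (auto simp: q_def field_simps)
  have meas[measurable]: "u \<in> borel_measurable (completion \<nu>)"
    using u by (auto simp: BV\<^sub>m0_def BV\<^sub>m_def)
  obtain A where A: "A \<in> sets (completion \<nu>)" "0 < emeasure (completion \<nu>) A"
      "emeasure (completion \<nu>) A < emeasure (completion \<nu>) UNIV" "\<And>x. x \<notin> A \<Longrightarrow> u x = 0"
    using u by (auto simp: BV\<^sub>m0_def)
  define U where "U k x = max (- real k) (min (real k) (u x))" for k :: nat and x
  have absU: "\<bar>U k x\<bar> = min \<bar>u x\<bar> (real k)" for k x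
    by (auto simp: U_def)
  have bound: "(\<integral>\<^sup>+ x. ennreal (\<bar>U k x\<bar> powr q) \<partial>\<nu>) \<le> ?K" for k
    unfolding q_def p_def
  proof (rule powr_integral_le_of_finite[OF n I sobolev _ A(1-3)])
    show "U k \<in> borel_measurable (completion \<nu>)"
      unfolding U_def by measurable
    show "U k x = 0" if "x \<notin> A" for x
      using A(4)[OF that] by (simp add: U_def)
    have "\<bar>U k x\<bar> powr q \<le> real k powr (q - 2) * (u x)\<^sup>2" for x
    proof -
      have "\<bar>U k x\<bar> powr q = \<bar>U k x\<bar> powr (q - 2) * (U k x)\<^sup>2"
        using powr_add[of "\<bar>U k x\<bar>" "q - 2" 2] by (cases "U k x = 0") auto
      also have "\<dots> \<le> real k powr (q - 2) * (u x)\<^sup>2"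
        using q absU[of k x]
        by (intro mult_mono powr_mono2) (auto simp flip: abs_le_square_iff)
      finally show ?thesis .
    qed
    then have "(\<integral>\<^sup>+ x. ennreal (\<bar>U k x\<bar> powr q) \<partial>\<nu>)
        \<le> (\<integral>\<^sup>+ x. ennreal (real k powr (q - 2)) * ennreal ((u x)\<^sup>2) \<partial>completion \<nu>)"
      unfolding nn_integral_completion
      by (intro nn_integral_mono) (simp add: ennreal_leI flip: ennreal_mult)
    also have "\<dots> = ennreal (real k powr (q - 2)) * (\<integral>\<^sup>+ x. ennreal ((u x)\<^sup>2) \<partial>completion \<nu>)"
      by (rule nn_integral_cmult) measurable
    also have "\<dots> < \<infinity>"
      using L2 by (simp add: ennreal_mult_less_top nn_integral_completion)
    finally show "(\<integral>\<^sup>+ x. ennreal (\<bar>U k x\<bar> powr (2 * n / (n - 2))) \<partial>\<nu>) < \<infinity>"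
      by (simp add: q_def)
    \<comment> \<open>Truncation is a contraction of the real line.\<close>
    have "(U k x - U k y)\<^sup>2 \<le> (u x - u y)\<^sup>2" for x y
      by (auto simp: U_def simp flip: abs_le_square_iff)
    then show "(\<integral>\<^sup>+ x. \<integral>\<^sup>+ y. ennreal ((U k x - U k y)\<^sup>2) \<partial>m x \<partial>\<nu>) \<le> ennreal d"
      by (intro order_trans[OF nn_integral_mono[OF nn_integral_mono] d(2)] ennreal_leI)
  qed (use d in auto)
  have "?S = (\<integral>\<^sup>+ x. (SUP k. ennreal (\<bar>U k x\<bar> powr q)) \<partial>completion \<nu>)"
    unfolding nn_integral_completion
  proof (rule nn_integral_cong)
    fix x
    obtain k0 where k0: "\<bar>u x\<bar> \<le> real k0"
      using real_arch_simple by blast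
    show "ennreal (\<bar>u x\<bar> powr q) = (SUP k. ennreal (\<bar>U k x\<bar> powr q))"
    proof (rule antisym)
      show "ennreal (\<bar>u x\<bar> powr q) \<le> (SUP k. ennreal (\<bar>U k x\<bar> powr q))"
        using k0 by (intro SUP_upper2[of k0]) (auto simp: absU)
      show "(SUP k. ennreal (\<bar>U k x\<bar> powr q)) \<le> ennreal (\<bar>u x\<bar> powr q)"
        using q by (intro SUP_least ennreal_leI powr_mono2) (auto simp: absU)
    qed
  qed
  also have "\<dots> = (SUP k. \<integral>\<^sup>+ x. ennreal (\<bar>U k x\<bar> powr q) \<partial>completion \<nu>)"
  proof (rule nn_integral_monotone_convergence_SUP)
    show "incseq (\<lambda>k x. ennreal (\<bar>U k x\<bar> powr q))"
      using q by (auto simp: incseq_def le_fun_def absU intro!: ennreal_leI powr_mono2)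
    show "(\<lambda>x. ennreal (\<bar>U k x\<bar> powr q)) \<in> borel_measurable (completion \<nu>)" for k
      unfolding U_def by measurable
  qed
  also have "\<dots> \<le> ?K"
    using bound by (intro SUP_least) (simp add: nn_integral_completion)
  finally show ?thesis .
qed

theorem theorem2p16:
  fixes m :: "'a::polish_space \<Rightarrow> 'a measure" and \<nu> :: "'a measure" and n :: real
  assumes "reversible_random_walk_space m \<nu>"
    and "m_connected m \<nu>"
    and "n > 2"
    and "\<exists>I::real. I > 0 \<and>
           (\<forall>u\<in>BV\<^sub>m0 m \<nu>. Lp_norm \<nu> (n / (n - 1)) u \<le> ennreal I * TV\<^sub>m m \<nu> u)"
  shows "\<exists>C::real. C > 0 \<and>
           (\<forall>u\<in>BV\<^sub>m0 m \<nu>. (Lp_norm \<nu> (2 * n / (n - 2)) u)\<^sup>2 \<le> ennreal C * H\<^sub>m m \<nu> u)"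
proof -
  interpret reversible_random_walk_space m \<nu> by fact
  note n = \<open>n > 2\<close>
  obtain I :: real where I: "0 < I"
    and sobolev: "\<And>w. w \<in> BV\<^sub>m0 m \<nu> \<Longrightarrow> Lp_norm \<nu> (n / (n - 1)) w \<le> ennreal I * TV\<^sub>m m \<nu> w"
    using assms(4) by blast
  define p where "p = 2 * (n - 1) / (n - 2)"
  define q where "q = 2 * n / (n - 2)"
  define C where "C = 2 * I\<^sup>2 * p\<^sup>2"
  have "0 < p" using n by (simp add: p_def)
  then have C: "0 < C" using I by (simp add: C_def)
  have "(Lp_norm \<nu> q u)\<^sup>2 \<le> ennreal C * H\<^sub>m m \<nu> u" if u: "u \<in> BV\<^sub>m0 m \<nu>" for u
  proof (cases "H\<^sub>m m \<nu> u")
    case top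
    then show ?thesis using C by (simp add: ennreal_mult_top)
  next
    case (real h)
    then have L2: "Lp_norm \<nu> 2 u < \<infinity>"
      and H: "H\<^sub>m m \<nu> u = 1 / 2 * (\<integral>\<^sup>+ x. \<integral>\<^sup>+ y. ennreal ((u x - u y)\<^sup>2) \<partial>m x \<partial>\<nu>)"
      by (auto simp: H\<^sub>m_def Lp_space_def split: if_splits)
    have fin: "(\<integral>\<^sup>+ x. ennreal ((u x)\<^sup>2) \<partial>\<nu>) < \<infinity>"
      using L2 by (auto simp: Lp_norm_def Let_def less_top split: if_splits)
    have "2 * (1 / 2 :: ennreal) = 1"
      by (simp add: ennreal_times_divide)
    then have "(\<integral>\<^sup>+ x. \<integral>\<^sup>+ y. ennreal ((u x - u y)\<^sup>2) \<partial>m x \<partial>\<nu>) = 2 * H\<^sub>m m \<nu> u"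
      unfolding H by (simp flip: mult.assoc)
    also have "\<dots> = ennreal (2 * h)"
      using real by (simp add: ennreal_mult)
    finally have D: "(\<integral>\<^sup>+ x. \<integral>\<^sup>+ y. ennreal ((u x - u y)\<^sup>2) \<partial>m x \<partial>\<nu>) \<le> ennreal (2 * h)"
      by simp
    define K where "K = I\<^sup>2 * (p\<^sup>2 * (2 * h))"
    have "(\<integral>\<^sup>+ x. ennreal (\<bar>u x\<bar> powr q) \<partial>\<nu>) \<le> ennreal (K powr (n / (n - 2)))"
      unfolding K_def p_def q_def using real
      by (intro powr_integral_le[OF n I sobolev u fin _ D]) auto
    then obtain s where s: "(\<integral>\<^sup>+ x. ennreal (\<bar>u x\<bar> powr q) \<partial>\<nu>) = ennreal s" "0 \<le> s"
        "s \<le> K powr (n / (n - 2))"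
      by (cases "\<integral>\<^sup>+ x. ennreal (\<bar>u x\<bar> powr q) \<partial>\<nu>") (auto simp: top_unique)
    have K: "0 \<le> K" using real by (simp add: K_def)
    have "s powr (1 / q) \<le> (K powr (n / (n - 2))) powr (1 / q)"
      using s n by (intro powr_mono2) (auto simp: q_def)
    also have "\<dots> = K powr (1 / 2)"
      using n by (simp add: powr_powr q_def)
    finally have "(s powr (1 / q))\<^sup>2 \<le> (K powr (1 / 2))\<^sup>2"
      by (intro power_mono) auto
    also have "\<dots> = K"
      using K by (simp add: powr_half_sqrt)
    also have "K = C * h"
      by (simp add: K_def C_def)
    finally have "(s powr (1 / q))\<^sup>2 \<le> C * h" .
    moreover have "Lp_norm \<nu> q u = ennreal (s powr (1 / q))"
      using s by (simp add: Lp_norm_def)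
    ultimately show ?thesis
      using real C by (simp add: ennreal_power ennreal_leI flip: ennreal_mult)
  qed
  then show ?thesis
    using C unfolding q_def by blast
qed

end
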